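(* If $\mu$ is any Ahlfors–David regular measure in $\mathbb{R}^n$ of order $n-\alpha$, where $0<\alpha<n$, then with $\beta=\frac{\alpha}{2}$ the inequality $$\int_{\mathbb{R}^n}M^\beta(\mathbf{1}_Q\mu)(x)^2\,dx\le C\sqrt{A_2^\alpha(\mu,\mu)}\,|Q|_\mu\qquad\text{for all cubes }Q\in\mathcal{P}^n$$ fails; that is, there is no finite positive constant $C$ for which it holds.
   Context: $\mathcal{P}^n$ is the collection of cubes in $\mathbb{R}^n$ with sides parallel to the coordinate axes; $\ell(Q)$ is the side length of $Q$, $3Q$ is the concentric cube with three times the side length, $|Q|_\mu=\mu(Q)$ and $|Q|$ is Lebesgue measure. All measures are locally finite positive Borel measures. A measure $\mu$ is Ahlfors–David regular of order $\theta$ if $|3Q|_\mu\approx\ell(Q)^\theta$ whenever $|Q|_\mu>0$, that is, if there are constants $0<c\le C'<\infty$ such that $c\,\ell(Q)^\theta\le|3Q|_\mu\le C'\ell(Q)^\theta$ for every cube $Q\in\mathcal{P}^n$ with $|Q|_\mu>0$. The fractional maximal function is $M^\beta\nu(x)=\sup_{x\in Q}|Q|^{\frac{\beta}{n}-1}\int_Qd\nu$, the supremum being over cubes $Q$ containing $x$. The $\alpha$-fractional Muckenhoupt constant is $A_2^\alpha(\sigma,\omega)=\sup_{Q\in\mathcal{P}^n}\frac{|Q|_\sigma}{|Q|^{1-\frac{\alpha}{n}}}\frac{|Q|_\omega}{|Q|^{1-\frac{\alpha}{n}}}$. *)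

theory Defs
  imports "HOL-Analysis.Analysis"
begin

definition cube :: "real ^ 'n \<Rightarrow> real \<Rightarrow> (real ^ 'n) set" where
  "cube c l = cbox (\<chi> i. c $ i - l / 2) (\<chi> i. c $ i + l / 2)"

(* Cubes are closed and non-degenerate. For l > 0, the cube Q = cube c l has side length l,
   and its concentric triple 3Q is cube c (3 * l). *)
definition cubes :: "(real ^ 'n) set set" where
  "cubes = {cube c l | c l. 0 < l}"

definition locally_finite_borel :: "(real ^ 'n) measure \<Rightarrow> bool" where
  "locally_finite_borel \<mu> \<longleftrightarrow>
     sets \<mu> = sets borel \<and> (\<forall>x. \<exists>U. open U \<and> x \<in> U \<and> emeasure \<mu> U < \<infinity>)"

definition ahlfors_david_regular :: "real \<Rightarrow> (real ^ 'n) measure \<Rightarrow> bool" where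
  "ahlfors_david_regular \<theta> \<mu> \<longleftrightarrow>
     (\<exists>c C' :: real. 0 < c \<and> c \<le> C' \<and>
       (\<forall>x l. 0 < l \<longrightarrow> emeasure \<mu> (cube x l) > 0 \<longrightarrow>
          ennreal (c * l powr \<theta>) \<le> emeasure \<mu> (cube x (3 * l)) \<and>
          emeasure \<mu> (cube x (3 * l)) \<le> ennreal (C' * l powr \<theta>)))"

definition frac_maximal :: "real \<Rightarrow> (real ^ 'n) measure \<Rightarrow> real ^ 'n \<Rightarrow> ennreal" where
  "frac_maximal \<beta> \<nu> x =
     (SUP Q \<in> {Q \<in> cubes. x \<in> Q}.
        ennreal (measure lborel Q powr (\<beta> / real CARD('n) - 1)) * emeasure \<nu> Q)"

definition A2_const :: "real \<Rightarrow> (real ^ 'n) measure \<Rightarrow> (real ^ 'n) measure \<Rightarrow> ennreal" where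
  "A2_const \<alpha> \<sigma> \<omega> =
     (SUP Q \<in> cubes.
        emeasure \<sigma> Q / ennreal (measure lborel Q powr (1 - \<alpha> / real CARD('n))) *
        (emeasure \<omega> Q / ennreal (measure lborel Q powr (1 - \<alpha> / real CARD('n)))))"

(* The case distinction is needed because enn2real \<infinity> = 0. *)
definition ennreal_sqrt :: "ennreal \<Rightarrow> ennreal" where
  "ennreal_sqrt a = (if a = \<infinity> then \<infinity> else ennreal (sqrt (enn2real a)))"

end

(* A regular measure of order n - alpha makes M^beta (1_Q mu) of size about d^(-alpha/2) at every
   point whose cube of side d charges mu (deep inside Q), and by Fubini these points have Lebesgue
   measure at least a constant times d^alpha.  Hence (M^beta (1_Q mu))^2 satisfies a reverse weak-type
   bound at all large levels, which is incompatible with integrability.  On the other hand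
   A_2^alpha(mu, mu) and |Q|_mu are finite. *)
theory Submission
  imports Defs "HOL-Real_Asymp.Real_Asymp"
begin

section \<open>Cubes and their Lebesgue measure\<close>

lemma mem_cube: "y \<in> cube c l \<longleftrightarrow> (\<forall>i. \<bar>y $ i - c $ i\<bar> \<le> l / 2)"
  unfolding cube_def mem_box_cart abs_diff_le_iff by simp

lemma mem_cube_commute: "y \<in> cube x l \<longleftrightarrow> x \<in> cube y l"
  by (auto simp: mem_cube abs_minus_commute)

lemma cube_mono: "l \<le> m \<Longrightarrow> cube c l \<subseteq> cube c m"
  by (simp add: subset_iff mem_cube) (meson divide_right_mono order_trans zero_le_numeral)

lemma cube_in_cubes: "0 < l \<Longrightarrow> cube c l \<in> cubes"
  unfolding cubes_def by blast

lemma closed_cube: "closed (cube c l)"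
  by (simp add: cube_def closed_cbox)

lemma cube_borel [measurable]: "cube c l \<in> sets borel"
  using closed_cube by (rule borel_closed)

lemma emeasure_lborel_cube:
  fixes c :: "real ^ 'n"
  assumes "0 \<le> l"
  shows "emeasure lborel (cube c l) = ennreal (l ^ CARD('n))"
proof -
  have "emeasure lborel (cube c l) = ennreal (\<Prod>b\<in>Basis. ((\<chi> i. c $ i + l / 2) - (\<chi> i. c $ i - l / 2)) \<bullet> b)"
    unfolding cube_def using assms
    by (subst emeasure_lborel_cbox) (auto simp: Basis_vec_def inner_axis)
  also have "(\<Prod>b\<in>(Basis :: (real ^ 'n) set). ((\<chi> i. c $ i + l / 2) - (\<chi> i. c $ i - l / 2)) \<bullet> b) = (\<Prod>b\<in>(Basis :: (real ^ 'n) set). l)"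
    by (rule prod.cong) (auto simp: Basis_vec_def inner_axis)
  finally show ?thesis by simp
qed

lemma measure_lborel_cube_powr:
  fixes c :: "real ^ 'n"
  assumes "0 < l"
  shows "measure lborel (cube c l) powr p = l powr (real CARD('n) * p)"
  using assms
  by (simp add: measure_def emeasure_lborel_cube powr_powr flip: powr_realpow)

section \<open>Double counting over cubes and reverse weak-type bounds\<close>

lemma nn_integral_emeasure_cube:
  fixes M :: "(real ^ 'n) measure"
  assumes "finite_measure M" and sets_M: "sets M = sets borel" and "0 \<le> l"
  shows "(\<lambda>x. emeasure M (cube x l)) \<in> borel_measurable borel" (is ?meas)
    and "(\<integral>\<^sup>+ x. emeasure M (cube x l) \<partial>lborel) = ennreal (l ^ CARD('n)) * emeasure M UNIV"
proof -
  interpret M: finite_measure M by fact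
  interpret pair_sigma_finite lborel M ..
  \<comment> \<open>The relation \<open>D\<close> is symmetric, so its slices in either variable are
    cubes of side \<open>l\<close>. Tonelli thus trades the \<open>M\<close>-measure of a cube
    around x for the Lebesgue measure of a cube around y, which is the same for every y.\<close>
  define D where "D = {p :: (real ^ 'n) \<times> (real ^ 'n). snd p \<in> cube (fst p) l}"
  have "D = (\<Inter>i. {p. \<bar>snd p $ i - fst p $ i\<bar> \<le> l / 2})"
    by (auto simp: D_def mem_cube)
  moreover have "closed {p :: (real ^ 'n) \<times> (real ^ 'n). \<bar>snd p $ i - fst p $ i\<bar> \<le> l / 2}" for i
    by (intro closed_Collect_le continuous_intros)
  ultimately have "D \<in> sets borel"
    by (auto intro!: borel_closed)
  then have D: "D \<in> sets (lborel \<Otimes>\<^sub>M M)"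
    by (subst sets_pair_measure_cong[OF sets_lborel sets_M]) (simp only: borel_prod)
  have slice: "Pair x -` D = cube x l" for x
    by (auto simp: D_def)
  show ?meas
    using M.measurable_emeasure_Pair[OF D] by (simp add: slice)
  have "(\<integral>\<^sup>+ x. emeasure M (cube x l) \<partial>lborel) = emeasure (lborel \<Otimes>\<^sub>M M) D"
    by (simp add: M.emeasure_pair_measure_alt[OF D] slice)
  also have "\<dots> = (\<integral>\<^sup>+ y. emeasure lborel ((\<lambda>x. (x, y)) -` D) \<partial>M)"
    by (rule emeasure_pair_measure_alt2[OF D])
  also have "(\<lambda>y. (\<lambda>x. (x, y)) -` D) = (\<lambda>y. cube y l)"
    by (auto simp: D_def mem_cube_commute)
  finally show "(\<integral>\<^sup>+ x. emeasure M (cube x l) \<partial>lborel) = ennreal (l ^ CARD('n)) * emeasure M UNIV"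
    using sets_eq_imp_space_eq[OF sets_M] assms by (simp add: emeasure_lborel_cube)
qed

text \<open>The average of \<open>emeasure M (cube x l)\<close> over x is known from Tonelli, while
  the integrand vanishes off the set of charging centres and is at most \<open>B\<close> on it. With
  \<open>B\<close> of order l^(n - alpha), the charging centres fill Lebesgue measure of order at
  least l^alpha.\<close>

lemma emeasure_charging_cubes_ge:
  fixes M :: "(real ^ 'n) measure"
  assumes "finite_measure M" and "sets M = sets borel" and "0 \<le> l"
    and B: "\<And>x. emeasure M (cube x l) \<le> B"
  shows "{x. emeasure M (cube x l) > 0} \<in> sets borel"
    and "ennreal (l ^ CARD('n)) * emeasure M UNIV \<le> B * emeasure lborel {x. emeasure M (cube x l) > 0}"
proof -
  let ?S = "{x. emeasure M (cube x l) > 0}"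
  note [measurable] = nn_integral_emeasure_cube(1)[OF assms(1-3)]
  show [measurable]: "?S \<in> sets borel"
    by measurable
  have "(\<integral>\<^sup>+ x. emeasure M (cube x l) \<partial>lborel) \<le> (\<integral>\<^sup>+ x. B * indicator ?S x \<partial>lborel)"
    by (intro nn_integral_mono) (use B in \<open>auto simp: indicator_def not_gr_zero\<close>)
  then show "ennreal (l ^ CARD('n)) * emeasure M UNIV \<le> B * emeasure lborel ?S"
    by (simp add: nn_integral_emeasure_cube(2)[OF assms(1-3)] nn_integral_cmult_indicator)
qed

text \<open>If the integral of \<open>f\<close> were finite, the level functions \<open>h k\<close>
  would have an integrable majorant and tend to 0 almost everywhere, so dominated convergence would
  send their integrals to 0, below \<open>e\<close>. The function \<open>f\<close> may fail to be
  measurable; the majorant is therefore the countable supremum \<open>g\<close> of the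
  \<open>h k\<close>, which lies below \<open>f\<close>.\<close>

lemma nn_integral_eq_top_if_reverse_weak_type:
  fixes f :: "'a \<Rightarrow> ennreal" and a :: "nat \<Rightarrow> real"
  assumes S [measurable]: "\<And>k. S k \<in> sets M"
    and a: "filterlim a at_top sequentially"
    and f: "\<And>k x. x \<in> S k \<Longrightarrow> ennreal (a k) \<le> f x"
    and e: "0 < e" "\<And>k. e \<le> ennreal (a k) * emeasure M (S k)"
  shows "(\<integral>\<^sup>+ x. f x \<partial>M) = \<infinity>"
proof (rule ccontr)
  assume fin: "(\<integral>\<^sup>+ x. f x \<partial>M) \<noteq> \<infinity>"
  define h where "h k x = ennreal (a k) * indicator (S k) x" for k x
  define g where "g x = (SUP k. h k x)" for x
  have [measurable]: "h k \<in> borel_measurable M" for k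
    by (simp add: h_def[abs_def])
  have [measurable]: "g \<in> borel_measurable M"
    by (simp add: g_def[abs_def])
  have hg: "h k x \<le> g x" for k x
    unfolding g_def by (rule SUP_upper) simp
  have "(\<integral>\<^sup>+ x. g x \<partial>M) \<le> (\<integral>\<^sup>+ x. f x \<partial>M)"
    by (intro nn_integral_mono) (auto simp: g_def h_def indicator_def f intro!: SUP_least)
  with fin have g_fin: "(\<integral>\<^sup>+ x. g x \<partial>M) < \<infinity>"
    by (auto simp: less_top top_unique)
  then have "AE x in M. g x \<noteq> \<infinity>"
    by (intro nn_integral_PInf_AE) auto
  moreover have "(\<lambda>k. h k x) \<longlonglongrightarrow> 0" if g_x: "g x \<noteq> \<infinity>" for x
  proof (rule tendsto_eventually)
    obtain r where r: "0 \<le> r" "g x = ennreal r"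
      using g_x by (cases "g x") auto
    \<comment> \<open>Once the level \<open>a k\<close> exceeds \<open>g x\<close>, the point x
      cannot lie in \<open>S k\<close>, since \<open>h k x\<close> would then be
      \<open>a k\<close>.\<close>
    have "eventually (\<lambda>k. r < a k) sequentially"
      using a by (simp add: filterlim_at_top_dense)
    then show "eventually (\<lambda>k. h k x = 0) sequentially"
    proof eventually_elim
      case (elim k)
      then show ?case
        using hg[of k x] r by (auto simp: h_def indicator_def split: if_splits)
    qed
  qed
  ultimately have "(\<lambda>k. \<integral>\<^sup>+ x. h k x \<partial>M) \<longlonglongrightarrow> (\<integral>\<^sup>+ x. 0 \<partial>M)"
    by (intro nn_integral_dominated_convergence[where w = g]) (use hg g_fin in auto)
  moreover have "(\<integral>\<^sup>+ x. h k x \<partial>M) = ennreal (a k) * emeasure M (S k)" for k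
    by (simp add: h_def nn_integral_cmult_indicator)
  ultimately have "e \<le> 0"
    using e(2) by (intro LIMSEQ_le_const) auto
  with e(1) show False by simp
qed

section \<open>Measures with the growth of a regular measure of order n - alpha\<close>

lemma exists_cube_emeasure_pos:
  fixes \<mu> :: "(real ^ 'n) measure"
  assumes sets: "sets \<mu> = sets borel" and "emeasure \<mu> (space \<mu>) \<noteq> 0"
  shows "\<exists>l>0. emeasure \<mu> (cube 0 l) > 0"
proof (rule ccontr)
  assume "\<not> ?thesis"
  then have null: "emeasure \<mu> (cube 0 (2 * real (Suc k))) = 0" for k
    by (auto simp: not_gr_zero)
  have "x \<in> (\<Union>k. cube 0 (2 * real (Suc k)))" for x :: "real ^ 'n"
  proof -
    obtain k where "norm x \<le> real k"
      using real_arch_simple by blast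
    then have "\<bar>x $ i - 0 $ i\<bar> \<le> 2 * real (Suc k) / 2" for i
      using component_le_norm_cart[of x i] by simp
    then have "x \<in> cube 0 (2 * real (Suc k))" unfolding mem_cube by blast
    then show ?thesis by blast
  qed
  then have "space \<mu> = (\<Union>k. cube 0 (2 * real (Suc k)))"
    using sets_eq_imp_space_eq[OF sets] by auto
  also have "emeasure \<mu> \<dots> = 0"
    by (rule emeasure_UN_eq_0) (use null sets in auto)
  finally show False using assms by simp
qed

text \<open>As |Q|^(1 - alpha/n) equals l^(n - alpha), the growth bound controls each of the two
  factors by the same constant, uniformly in Q.\<close>

lemma A2_const_less_top:
  fixes \<mu> :: "(real ^ 'n) measure"
  assumes upper: "\<And>x l. 0 < l \<Longrightarrow> emeasure \<mu> (cube x l) \<le> ennreal (B * l powr (real CARD('n) - \<alpha>))"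
  shows "A2_const \<alpha> \<mu> \<mu> < \<infinity>"
proof -
  have "emeasure \<mu> Q / ennreal (measure lborel Q powr (1 - \<alpha> / real CARD('n))) \<le> ennreal B"
    if cube_Q: "Q \<in> cubes" for Q
  proof -
    obtain c l where Q: "Q = cube c l" "0 < l"
      using cube_Q by (auto simp: cubes_def)
    have "measure lborel Q powr (1 - \<alpha> / real CARD('n)) = l powr (real CARD('n) - \<alpha>)"
      using Q by (simp add: measure_lborel_cube_powr right_diff_distrib)
    moreover have "emeasure \<mu> Q / ennreal (l powr (real CARD('n) - \<alpha>))
        \<le> ennreal B * ennreal (l powr (real CARD('n) - \<alpha>)) / ennreal (l powr (real CARD('n) - \<alpha>))"
      using upper[OF Q(2), of c] Q by (intro divide_right_mono_ennreal) (simp add: ennreal_mult'')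
    ultimately show ?thesis
      using Q by (simp add: ennreal_mult_divide_eq)
  qed
  then have "A2_const \<alpha> \<mu> \<mu> \<le> ennreal B * ennreal B"
    unfolding A2_const_def by (intro SUP_least mult_mono) auto
  also have "\<dots> < \<infinity>" by (simp add: ennreal_mult_less_top)
  finally show ?thesis .
qed

text \<open>Mass is counted in the inner cube \<open>cube z l\<close>, but the maximal function uses
  \<mu> on its triple. The margin lets small test cubes around charging points fit inside the
  triple, so the restriction loses none of their mass.\<close>

lemma nn_integral_frac_maximal_eq_top:
  fixes \<mu> :: "(real ^ 'n) measure"
  assumes sets: "sets \<mu> = sets borel" and "0 < \<alpha>" and "0 < c"
    and lower: "\<And>x l. 0 < l \<Longrightarrow> emeasure \<mu> (cube x l) > 0 \<Longrightarrow>
      ennreal (c * l powr (real CARD('n) - \<alpha>)) \<le> emeasure \<mu> (cube x (3 * l))"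
    and upper: "\<And>x l. 0 < l \<Longrightarrow> emeasure \<mu> (cube x l) \<le> ennreal (B * l powr (real CARD('n) - \<alpha>))"
    and "0 < l" and pos: "emeasure \<mu> (cube z l) > 0"
  shows "(\<integral>\<^sup>+ x. (frac_maximal (\<alpha> / 2) (density \<mu> (indicator (cube z (3 * l)))) x)\<^sup>2 \<partial>lborel) = \<infinity>"
proof -
  let ?n = "real CARD('n)" and ?Q = "cube z (3 * l)"
  define M where "M = density \<mu> (indicator (cube z l))"
  have M: "emeasure M X = emeasure \<mu> (cube z l \<inter> X)" if "X \<in> sets borel" for X
    unfolding M_def using that by (intro emeasure_restricted) (auto simp: sets)
  have sets_M: "sets M = sets borel"
    by (simp add: M_def sets)
  \<comment> \<open>The growth bound at the charged cube forces the sign of \<open>B\<close>, which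
    is a denominator below.\<close>
  have "0 < B"
  proof (rule ccontr)
    assume "\<not> 0 < B"
    then have "B * l powr (?n - \<alpha>) \<le> 0" by (simp add: mult_nonpos_nonneg)
    then show False using upper[OF \<open>0 < l\<close>, of z] pos by (simp add: ennreal_neg)
  qed
  have M_UNIV: "emeasure M UNIV = emeasure \<mu> (cube z l)"
    by (simp add: M)
  have "space M = UNIV"
    using sets_eq_imp_space_eq[OF sets_M] by simp
  moreover have "emeasure \<mu> (cube z l) < \<infinity>"
    using upper[OF \<open>0 < l\<close>, of z] by (rule le_less_trans) simp
  ultimately have fin_M: "finite_measure M"
    by (intro finite_measureI) (simp add: M_UNIV)
  \<comment> \<open>A null sequence of side lengths, at most l/2 so that the test cubes of side
    \<open>3 * d k\<close> stay in \<open>?Q\<close>.\<close>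
  define d where "d k = l / 2 / real (Suc k)" for k
  have d: "0 < d k" "2 * d k \<le> l" for k
  proof -
    show "0 < d k" using \<open>0 < l\<close> by (simp add: d_def)
    have "2 * d k = l / real (Suc k)" by (simp add: d_def del: of_nat_Suc)
    also have "\<dots> \<le> l / 1" using \<open>0 < l\<close> by (intro divide_left_mono) auto
    finally show "2 * d k \<le> l" by simp
  qed
  \<comment> \<open>A test cube of side 3d contributes (3d)^(alpha/2 - n) times mass at least c d^(n
    - alpha), that is, K d^(-alpha/2). The level \<open>a k\<close> is the square of this.\<close>
  define K where "K = 3 powr (\<alpha> / 2 - ?n) * c"
  have "0 < K" using \<open>0 < c\<close> by (simp add: K_def)
  define a where "a k = K\<^sup>2 * d k powr (- \<alpha>)" for k
  define S where "S k = {x. emeasure M (cube x (d k)) > 0}" for k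
  have M_le: "emeasure M (cube x r) \<le> ennreal (B * r powr (?n - \<alpha>))" if "0 < r" for x r
  proof -
    have "emeasure M (cube x r) \<le> emeasure \<mu> (cube x r)"
      by (simp add: M) (rule emeasure_mono, auto simp: sets)
    also note upper[OF that]
    finally show ?thesis .
  qed
  note charging = emeasure_charging_cubes_ge[OF fin_M sets_M less_imp_le[OF d(1)] M_le[OF d(1)]]
  show ?thesis
  proof (rule nn_integral_eq_top_if_reverse_weak_type)
    show "S k \<in> sets lborel" for k
      using charging(1) by (simp add: S_def)
    have "filterlim (\<lambda>k. d k powr (- \<alpha>)) at_top sequentially"
      unfolding d_def using \<open>0 < l\<close> \<open>0 < \<alpha>\<close> by real_asymp
    then show "filterlim a at_top sequentially"
      unfolding a_def using \<open>0 < K\<close>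
      by (intro filterlim_tendsto_pos_mult_at_top[OF tendsto_const]) auto
    show "ennreal (a k) \<le> (frac_maximal (\<alpha> / 2) (density \<mu> (indicator ?Q)) x)\<^sup>2" if "x \<in> S k" for k x
    proof -
      have x: "emeasure \<mu> (cube z l \<inter> cube x (d k)) > 0"
        using that by (simp add: S_def M)
      then obtain y where "y \<in> cube z l" "y \<in> cube x (d k)"
        by (metis disjoint_iff emeasure_empty less_irrefl)
      \<comment> \<open>Going from w through x and y to z costs at most 3d/2 + d/2 + l/2 in each
        coordinate, and 2d \<le> l makes this at most 3l/2.\<close>
      have "cube x (3 * d k) \<subseteq> ?Q"
      proof
        fix w assume "w \<in> cube x (3 * d k)"
        have "\<bar>w $ i - z $ i\<bar> \<le> 3 * l / 2" for i
        proof -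
          have "\<bar>w $ i - x $ i\<bar> \<le> 3 * d k / 2" "\<bar>y $ i - x $ i\<bar> \<le> d k / 2" "\<bar>y $ i - z $ i\<bar> \<le> l / 2"
            using \<open>w \<in> _\<close> \<open>y \<in> cube z l\<close> \<open>y \<in> cube x (d k)\<close> by (auto simp: mem_cube)
          then show ?thesis using d(2)[of k] by linarith
        qed
        then show "w \<in> ?Q" by (simp add: mem_cube)
      qed
      then have restr: "emeasure (density \<mu> (indicator ?Q)) (cube x (3 * d k)) = emeasure \<mu> (cube x (3 * d k))"
        by (subst emeasure_restricted) (auto simp: sets Int_absorb1)
      have "emeasure \<mu> (cube z l \<inter> cube x (d k)) \<le> emeasure \<mu> (cube x (d k))"
        by (rule emeasure_mono) (auto simp: sets)
      with x have low: "ennreal (c * d k powr (?n - \<alpha>)) \<le> emeasure \<mu> (cube x (3 * d k))"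
        by (intro lower d) auto
      have "d k powr (\<alpha> / 2 - ?n) * d k powr (?n - \<alpha>) = d k powr (- (\<alpha> / 2))"
        by (simp flip: powr_add)
      then have "K * d k powr (- (\<alpha> / 2)) = (3 * d k) powr (\<alpha> / 2 - ?n) * (c * d k powr (?n - \<alpha>))"
        using d(1)[of k] by (simp add: K_def powr_mult)
      also have "ennreal \<dots> \<le> ennreal (measure lborel (cube x (3 * d k)) powr (\<alpha> / 2 / ?n - 1))
          * emeasure (density \<mu> (indicator ?Q)) (cube x (3 * d k))"
        using d(1)[of k] \<open>0 < c\<close> low
        by (simp add: ennreal_mult restr measure_lborel_cube_powr right_diff_distrib mult_left_mono)
      also have "\<dots> \<le> frac_maximal (\<alpha> / 2) (density \<mu> (indicator ?Q)) x"
        unfolding frac_maximal_def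
        by (rule SUP_upper) (use d(1)[of k] in \<open>simp add: cube_in_cubes mem_cube\<close>)
      finally have "(ennreal (K * d k powr (- (\<alpha> / 2))))\<^sup>2
          \<le> (frac_maximal (\<alpha> / 2) (density \<mu> (indicator ?Q)) x)\<^sup>2"
        by (rule power_mono) simp
      moreover have "(d k powr (- (\<alpha> / 2)))\<^sup>2 = d k powr (- \<alpha>)"
        by (simp add: power2_eq_square flip: powr_add)
      then have "a k = (K * d k powr (- (\<alpha> / 2)))\<^sup>2"
        by (simp add: a_def power_mult_distrib)
      ultimately show ?thesis
        using \<open>0 < K\<close> by (simp add: ennreal_power)
    qed
    \<comment> \<open>The set \<open>S k\<close> has Lebesgue measure at least d^alpha/B times the
      mass of \<open>cube z l\<close>. The level K^2 d^(-alpha) cancels the power of d, leaving a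
      bound independent of k.\<close>
    show "0 < ennreal (K\<^sup>2 / B) * emeasure \<mu> (cube z l)"
      using pos \<open>0 < K\<close> \<open>0 < B\<close> by (simp add: ennreal_zero_less_mult_iff)
    show "ennreal (K\<^sup>2 / B) * emeasure \<mu> (cube z l) \<le> ennreal (a k) * emeasure lborel (S k)" for k
    proof -
      \<comment> \<open>Inserting d^(-n) d^n produces the left side of the charging estimate as a
        factor, so that estimate is multiplied by a constant and no division in
        \<open>ennreal\<close> is needed.\<close>
      have "d k powr (- ?n) * d k ^ CARD('n) = 1"
        using d(1)[of k] by (simp add: powr_minus powr_realpow)
      then have 1: "K\<^sup>2 / B = K\<^sup>2 / B * d k powr (- ?n) * d k ^ CARD('n)"
        by (simp only: mult.assoc mult_1_right)
      have "d k powr (- ?n) * d k powr (?n - \<alpha>) = d k powr (- \<alpha>)"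
        by (simp flip: powr_add)
      then have 2: "a k = K\<^sup>2 / B * d k powr (- ?n) * (B * d k powr (?n - \<alpha>))"
        using \<open>0 < B\<close> by (simp add: a_def)
      have "ennreal (K\<^sup>2 / B) * emeasure \<mu> (cube z l)
          = ennreal (K\<^sup>2 / B * d k powr (- ?n)) * (ennreal (d k ^ CARD('n)) * emeasure M UNIV)"
        using d(1)[of k] \<open>0 < B\<close> by (subst 1, subst ennreal_mult) (simp_all add: M_UNIV mult.assoc)
      also have "\<dots> \<le> ennreal (K\<^sup>2 / B * d k powr (- ?n)) * (ennreal (B * d k powr (?n - \<alpha>)) * emeasure lborel (S k))"
        unfolding S_def by (intro mult_left_mono charging(2)) simp
      also have "\<dots> = ennreal (a k) * emeasure lborel (S k)"
        using \<open>0 < B\<close> by (subst 2, subst ennreal_mult) (simp_all add: mult.assoc)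
      finally show ?thesis .
    qed
  qed
qed

theorem lemma8:
  fixes \<mu> :: "(real ^ 'n) measure" and \<alpha> :: real
  assumes "locally_finite_borel \<mu>"
    and "emeasure \<mu> (space \<mu>) \<noteq> 0"
    and "0 < \<alpha>" and "\<alpha> < real CARD('n)"
    and "ahlfors_david_regular (real CARD('n) - \<alpha>) \<mu>"
  shows "\<not> (\<exists>C :: real. 0 < C \<and>
           (\<forall>Q \<in> cubes.
              (\<integral>\<^sup>+ x. (frac_maximal (\<alpha> / 2) (density \<mu> (indicator Q)) x)\<^sup>2 \<partial>lborel)
                \<le> ennreal C * ennreal_sqrt (A2_const \<alpha> \<mu> \<mu>) * emeasure \<mu> Q))"
proof
  assume "\<exists>C :: real. 0 < C \<and>
           (\<forall>Q \<in> cubes.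
              (\<integral>\<^sup>+ x. (frac_maximal (\<alpha> / 2) (density \<mu> (indicator Q)) x)\<^sup>2 \<partial>lborel)
                \<le> ennreal C * ennreal_sqrt (A2_const \<alpha> \<mu> \<mu>) * emeasure \<mu> Q)"
  then obtain C where C: "\<And>Q. Q \<in> cubes \<Longrightarrow>
      (\<integral>\<^sup>+ x. (frac_maximal (\<alpha> / 2) (density \<mu> (indicator Q)) x)\<^sup>2 \<partial>lborel)
        \<le> ennreal C * ennreal_sqrt (A2_const \<alpha> \<mu> \<mu>) * emeasure \<mu> Q"
    by blast
  have sets: "sets \<mu> = sets borel"
    using assms(1) by (simp add: locally_finite_borel_def)
  obtain c B where "0 < c"
    and lower: "\<And>x l. 0 < l \<Longrightarrow> emeasure \<mu> (cube x l) > 0 \<Longrightarrow>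
      ennreal (c * l powr (real CARD('n) - \<alpha>)) \<le> emeasure \<mu> (cube x (3 * l))"
    and upper3: "\<And>x l. 0 < l \<Longrightarrow> emeasure \<mu> (cube x l) > 0 \<Longrightarrow>
      emeasure \<mu> (cube x (3 * l)) \<le> ennreal (B * l powr (real CARD('n) - \<alpha>))"
    using assms(5) unfolding ahlfors_david_regular_def by blast
  \<comment> \<open>Regularity bounds the triple of a charged cube, hence the cube itself; for null
    cubes the bound is trivial. This yields growth for all cubes.\<close>
  have upper: "emeasure \<mu> (cube x l) \<le> ennreal (B * l powr (real CARD('n) - \<alpha>))" if "0 < l" for x l
  proof (cases "emeasure \<mu> (cube x l) > 0")
    case True
    have "emeasure \<mu> (cube x l) \<le> emeasure \<mu> (cube x (3 * l))"
      using that by (intro emeasure_mono cube_mono) (auto simp: sets)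
    with upper3[OF that True] show ?thesis by simp
  qed (simp add: not_gr_zero)
  \<comment> \<open>The zero measure is vacuously regular and makes both sides of the inequality
    vanish; it is excluded here by choosing a charged cube.\<close>
  obtain l where l: "0 < l" "emeasure \<mu> (cube 0 l) > 0"
    using exists_cube_emeasure_pos[OF sets assms(2)] by blast
  let ?Q = "cube (0 :: real ^ 'n) (3 * l)"
  have "?Q \<in> cubes"
    using l(1) by (simp add: cube_in_cubes)
  \<comment> \<open>The inequality already fails on this single cube: its left side is infinite,
    while all three factors on the right are finite.\<close>
  then have "\<infinity> \<le> ennreal C * ennreal_sqrt (A2_const \<alpha> \<mu> \<mu>) * emeasure \<mu> ?Q"
    using C[of ?Q] nn_integral_frac_maximal_eq_top[OF sets assms(3) \<open>0 < c\<close> lower upper l]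
    by simp
  moreover have "emeasure \<mu> ?Q < \<infinity>"
    by (rule le_less_trans[OF upper]) (use l(1) in auto)
  moreover have "ennreal_sqrt (A2_const \<alpha> \<mu> \<mu>) < \<infinity>"
    using A2_const_less_top[OF upper] by (auto simp: ennreal_sqrt_def)
  ultimately show False
    by (auto simp: top_unique ennreal_mult_eq_top_iff)
qed

end
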